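(* Let $n\ge 3$ and let $A\in\mathbb{C}^{n\times n}$ have the block form $$A=\begin{pmatrix}\lambda & b^\star\\ 0& D\end{pmatrix},$$ where $\lambda\in\mathbb{C}$ (an eigenvalue of $A$), $b\in\mathbb{C}^{(n-1)\times 1}$ and $D\in\mathbb{C}^{(n-1)\times(n-1)}$. (1) If $b=0$, then $\lambda$ is also a secondary value of $A$. (2) If $\lambda\notin W(D)$ and $\lambda$ is a secondary value of $A$, then $b=0$.
   Context: The numerical range is $W(D)=\{u^\star Du/u^\star u: u\ne0\}$. A secondary value of $A\in\mathbb{C}^{n\times n}$, $n\ge3$, is a solution $x\in\mathbb{C}$ of $\operatorname{tr}\big(\operatorname{adj}(xI-A)(A^\star-\bar A)\big)=0$, where $\operatorname{adj}$ is the adjugate and $\bar A$ (not the entrywise conjugate) denotes any matrix satisfying: $\bar AA=A\bar A$; $\overline{Q^{-1}AQ}=Q^{-1}\bar AQ$ for all invertible $Q$; and $Au=\mu u$ implies $\bar Au=\bar\mu u$. It need not be unique, but $\operatorname{tr}(\operatorname{adj}(xI-A)\bar A)=\det(xI-A)\sum_j\frac{\bar\lambda_j}{x-\lambda_j}$ for $x\notin\sigma(A)$ (with $\lambda_j$ the eigenvalues of $A$ with multiplicity), so the equation does not depend on the choice. *)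

theory Defs
  imports
    Complex_Main
    "Jordan_Normal_Form.Schur_Decomposition"
    "Jordan_Normal_Form.Spectral_Radius"
begin

definition mat_trace :: "'a :: comm_monoid_add mat \<Rightarrow> 'a" where
  "mat_trace A = (\<Sum>i<dim_row A. A $$ (i, i))"

text \<open>Since \<open>v \<bullet>c u\<close> conjugates its second argument, \<open>(D *\<^sub>v u) \<bullet>c u\<close> is \<open>u\<^sup>* D u\<close>.\<close>

definition numerical_range :: "complex mat \<Rightarrow> complex set" where
  "numerical_range D =
     {((D *\<^sub>v u) \<bullet>c u) / (u \<bullet>c u) | u. u \<in> carrier_vec (dim_row D) \<and> u \<noteq> 0\<^sub>v (dim_row D)}"

text \<open>
  The matrix \<open>A\<close>-bar is only specified up to three conditions, the second of which relates its
  values at different (similar) matrices. So the bar is modelled as a map \<open>bar\<close> on the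
  \<open>n \<times> n\<close> matrices, and any map meeting the conditions is admitted. The second condition is
  stated with \<open>P\<close> in the role of the inverse of \<open>Q\<close>.
\<close>

definition conj_map :: "nat \<Rightarrow> (complex mat \<Rightarrow> complex mat) \<Rightarrow> bool" where
  "conj_map n bar \<longleftrightarrow>
     (\<forall>A \<in> carrier_mat n n. bar A \<in> carrier_mat n n) \<and>
     (\<forall>A \<in> carrier_mat n n. bar A * A = A * bar A) \<and>
     (\<forall>A \<in> carrier_mat n n. \<forall>Q \<in> carrier_mat n n. \<forall>P \<in> carrier_mat n n.
        inverts_mat Q P \<longrightarrow> inverts_mat P Q \<longrightarrow> bar (P * A * Q) = P * bar A * Q) \<and>
     (\<forall>A \<in> carrier_mat n n. \<forall>u \<in> carrier_vec n. \<forall>\<mu>.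
        A *\<^sub>v u = \<mu> \<cdot>\<^sub>v u \<longrightarrow> bar A *\<^sub>v u = cnj \<mu> \<cdot>\<^sub>v u)"

definition secondary_value ::
  "(complex mat \<Rightarrow> complex mat) \<Rightarrow> complex mat \<Rightarrow> complex \<Rightarrow> bool" where
  "secondary_value bar A x \<longleftrightarrow>
     mat_trace (adj_mat (x \<cdot>\<^sub>m 1\<^sub>m (dim_row A) - A) * (mat_adjoint A - bar A)) = 0"

text \<open>
  Such maps exist for every \<open>n\<close>: evaluate at \<open>A\<close> the Newton interpolation polynomial of complex
  conjugation at the distinct eigenvalues of \<open>A\<close>.
\<close>

primrec newton_mat ::
  "nat \<Rightarrow> complex mat \<Rightarrow> complex list \<Rightarrow> (complex \<Rightarrow> complex) \<Rightarrow> complex mat" where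
  "newton_mat n A [] f = 0\<^sub>m n n"
| "newton_mat n A (r # rs) f =
     f r \<cdot>\<^sub>m 1\<^sub>m n + newton_mat n A rs (\<lambda>x. (f x - f r) / (x - r)) * (A - r \<cdot>\<^sub>m 1\<^sub>m n)"

lemma newton_mat_carrier:
  "A \<in> carrier_mat n n \<Longrightarrow> newton_mat n A rs f \<in> carrier_mat n n"
  by (induction rs arbitrary: f)
    (auto intro!: add_carrier_mat mult_carrier_mat minus_carrier_mat smult_carrier_mat)

lemma newton_mat_commute:
  assumes A: "A \<in> carrier_mat n n"
  shows "newton_mat n A rs f * A = A * newton_mat n A rs f"
proof (induction rs arbitrary: f)
  case Nil
  then show ?case using A by auto
next
  case (Cons r rs)
  define N where "N = newton_mat n A rs (\<lambda>x. (f x - f r) / (x - r))"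
  define B where "B = A - r \<cdot>\<^sub>m 1\<^sub>m n"
  have N: "N \<in> carrier_mat n n" unfolding N_def by (rule newton_mat_carrier[OF A])
  have B: "B \<in> carrier_mat n n" using A by (auto simp: B_def)
  have NA: "N * A = A * N" unfolding N_def by (rule Cons.IH)
  have I: "f r \<cdot>\<^sub>m 1\<^sub>m n \<in> carrier_mat n n" "r \<cdot>\<^sub>m 1\<^sub>m n \<in> carrier_mat n n" by auto
  have sc: "(c \<cdot>\<^sub>m 1\<^sub>m n) * A = A * (c \<cdot>\<^sub>m 1\<^sub>m n)" for c
    using A mult_smult_assoc_mat[OF one_carrier_mat A, of c]
      mult_smult_distrib[OF A one_carrier_mat, of c] by simp
  have BA: "B * A = A * B"
    unfolding B_def using A I(2) sc
    by (simp add: minus_mult_distrib_mat[OF A I(2) A] mult_minus_distrib_mat[OF A A I(2)])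
  have "N * B * A = A * (N * B)"
    using N B A NA BA assoc_mult_mat[OF N B A] assoc_mult_mat[OF N A B] assoc_mult_mat[OF A N B]
    by simp
  then have "(f r \<cdot>\<^sub>m 1\<^sub>m n + N * B) * A = A * (f r \<cdot>\<^sub>m 1\<^sub>m n + N * B)"
    using N B A sc
    by (subst add_mult_distrib_mat[OF I(1) _ A], force,
        subst mult_add_distrib_mat[OF A I(1)], auto)
  then show ?case unfolding newton_mat.simps N_def B_def .
qed

lemma newton_mat_similar:
  assumes A: "A \<in> carrier_mat n n" and Q: "Q \<in> carrier_mat n n" and P: "P \<in> carrier_mat n n"
    and QP: "Q * P = 1\<^sub>m n" and PQ: "P * Q = 1\<^sub>m n"
  shows "newton_mat n (P * A * Q) rs f = P * newton_mat n A rs f * Q"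
proof (induction rs arbitrary: f)
  case Nil
  then show ?case using P Q by auto
next
  case (Cons r rs)
  define N where "N = newton_mat n A rs (\<lambda>x. (f x - f r) / (x - r))"
  define B where "B = A - r \<cdot>\<^sub>m 1\<^sub>m n"
  have N: "N \<in> carrier_mat n n" unfolding N_def by (rule newton_mat_carrier[OF A])
  have B: "B \<in> carrier_mat n n" using A by (auto simp: B_def)
  have sc: "P * (c \<cdot>\<^sub>m 1\<^sub>m n) * Q = c \<cdot>\<^sub>m 1\<^sub>m n" for c
    using P Q PQ by (simp add: mult_smult_distrib[OF P one_carrier_mat]
        mult_smult_assoc_mat[OF P Q])
  have I: "c \<cdot>\<^sub>m 1\<^sub>m n \<in> carrier_mat n n" for c :: complex by auto
  have PA: "P * A \<in> carrier_mat n n" and PN: "P * N \<in> carrier_mat n n"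
    and PI: "P * (c \<cdot>\<^sub>m 1\<^sub>m n) \<in> carrier_mat n n" and NB: "N * B \<in> carrier_mat n n" for c
    using P A N B by auto
  have 1: "P * B * Q = P * A * Q - r \<cdot>\<^sub>m 1\<^sub>m n"
    unfolding B_def mult_minus_distrib_mat[OF P A I] minus_mult_distrib_mat[OF PA PI Q] sc ..
  have PB: "P * B \<in> carrier_mat n n" and BQ: "B * Q \<in> carrier_mat n n"
    using P B Q by auto
  have 2: "P * (N * B) * Q = (P * N * Q) * (P * B * Q)"
  proof -
    have "(P * N * Q) * (P * B * Q) = P * N * (Q * (P * (B * Q)))"
      using assoc_mult_mat[OF P B Q] assoc_mult_mat[OF PN Q, of "P * (B * Q)" n] P BQ by simp
    also have "Q * (P * (B * Q)) = B * Q"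
      using assoc_mult_mat[OF Q P BQ] left_mult_one_mat[OF BQ] QP by metis
    also have "P * N * (B * Q) = P * (N * B) * Q"
      using assoc_mult_mat[OF PN B Q] assoc_mult_mat[OF P N B] by simp
    finally show ?thesis by simp
  qed
  have "P * (f r \<cdot>\<^sub>m 1\<^sub>m n + N * B) * Q = f r \<cdot>\<^sub>m 1\<^sub>m n + P * (N * B) * Q"
    using P NB by (subst mult_add_distrib_mat[OF P I NB],
        subst add_mult_distrib_mat[OF PI _ Q], auto simp: sc)
  then show ?case
    unfolding newton_mat.simps Cons.IH 2 1 N_def[symmetric] B_def[symmetric] by simp
qed

lemma newton_mat_eigenvector:
  assumes A: "A \<in> carrier_mat n n" and u: "u \<in> carrier_vec n" and eq: "A *\<^sub>v u = \<mu> \<cdot>\<^sub>v u"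
    and "\<mu> \<in> set rs"
  shows "newton_mat n A rs f *\<^sub>v u = f \<mu> \<cdot>\<^sub>v u"
  using \<open>\<mu> \<in> set rs\<close>
proof (induction rs arbitrary: f)
  case (Cons r rs)
  define g where "g = (\<lambda>x. (f x - f r) / (x - r))"
  define N where "N = newton_mat n A rs g"
  have N: "N \<in> carrier_mat n n" unfolding N_def by (rule newton_mat_carrier[OF A])
  have B: "A - r \<cdot>\<^sub>m 1\<^sub>m n \<in> carrier_mat n n" and I: "c \<cdot>\<^sub>m 1\<^sub>m n \<in> carrier_mat n n" for c :: complex
    using A by auto
  have sc: "(c \<cdot>\<^sub>m 1\<^sub>m n) *\<^sub>v u = c \<cdot>\<^sub>v u" for c
    using u by (intro eq_vecI) (auto simp: scalar_prod_def if_distrib if_distribR cong: if_cong)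
  have Bu: "(A - r \<cdot>\<^sub>m 1\<^sub>m n) *\<^sub>v u = (\<mu> - r) \<cdot>\<^sub>v u"
    using minus_mult_distrib_mat_vec[OF A I u] u by (auto simp: eq sc left_diff_distrib)
  have "N *\<^sub>v ((\<mu> - r) \<cdot>\<^sub>v u) = (f \<mu> - f r) \<cdot>\<^sub>v u"
  proof (cases "\<mu> = r")
    case True
    have "N *\<^sub>v ((\<mu> - r) \<cdot>\<^sub>v u) = (\<mu> - r) \<cdot>\<^sub>v (N *\<^sub>v u)"
      by (rule mult_mat_vec[OF N u])
    then show ?thesis using True u N by auto
  next
    case False
    then have "N *\<^sub>v u = g \<mu> \<cdot>\<^sub>v u"
      using Cons.prems Cons.IH[of g] by (simp add: N_def)
    then show ?thesis
      using False by (simp add: mult_mat_vec[OF N u] smult_smult_assoc g_def)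
  qed
  then have "(f r \<cdot>\<^sub>m 1\<^sub>m n + N * (A - r \<cdot>\<^sub>m 1\<^sub>m n)) *\<^sub>v u = f r \<cdot>\<^sub>v u + (f \<mu> - f r) \<cdot>\<^sub>v u"
    using N B u by (subst add_mult_distrib_mat_vec[OF I _ u])
      (auto simp: sc assoc_mult_mat_vec[OF N B u] Bu)
  also have "\<dots> = f \<mu> \<cdot>\<^sub>v u"
    using u by (auto simp: add_smult_distrib_vec[symmetric])
  finally show ?case unfolding newton_mat.simps N_def g_def .
qed simp

lemma conj_map_exists: "\<exists>bar. conj_map n bar"
proof -
  define rts where "rts A = (SOME rs. set rs = spectrum A)" for A :: "complex mat"
  define bar where "bar A = newton_mat n A (rts A) cnj" for A
  have rts: "set (rts A) = spectrum A" if "A \<in> carrier_mat n n" for A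
    unfolding rts_def using finite_list[OF card_finite_spectrum(1)[OF that]] by (rule someI_ex)
  have sim: "bar (P * A * Q) = P * bar A * Q"
    if A: "A \<in> carrier_mat n n" and Q: "Q \<in> carrier_mat n n" and P: "P \<in> carrier_mat n n"
      and "inverts_mat Q P" "inverts_mat P Q" for A P Q
  proof -
    have inv: "Q * P = 1\<^sub>m n" "P * Q = 1\<^sub>m n"
      using that by (auto simp: inverts_mat_def)
    have B: "P * A * Q \<in> carrier_mat n n" using A P Q by auto
    have "similar_mat (P * A * Q) A"
      unfolding similar_mat_def
      by (rule exI[of _ P], rule exI[of _ Q], rule similar_mat_witI[of _ _ n]) (use A P Q inv in auto)
    then have "char_poly (P * A * Q) = char_poly A" by (rule char_poly_similar)
    then have "spectrum (P * A * Q) = spectrum A"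
      by (auto simp: spectrum_def eigenvalue_root_char_poly[OF A] eigenvalue_root_char_poly[OF B])
    then show ?thesis
      unfolding bar_def rts_def by (simp add: newton_mat_similar[OF A Q P inv])
  qed
  have eig: "bar A *\<^sub>v u = cnj \<mu> \<cdot>\<^sub>v u"
    if A: "A \<in> carrier_mat n n" and u: "u \<in> carrier_vec n" and eq: "A *\<^sub>v u = \<mu> \<cdot>\<^sub>v u" for A u \<mu>
  proof (cases "u = 0\<^sub>v n")
    case True
    have "bar A \<in> carrier_mat n n" unfolding bar_def by (rule newton_mat_carrier[OF A])
    then show ?thesis using True by (intro eq_vecI) auto
  next
    case False
    then have "\<mu> \<in> spectrum A"
      using A u eq by (auto simp: spectrum_def eigenvalue_def eigenvector_def)
    then show ?thesis
      unfolding bar_def by (intro newton_mat_eigenvector[OF A u eq]) (simp add: rts[OF A])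
  qed
  have "conj_map n bar"
    unfolding conj_map_def using sim eig newton_mat_carrier newton_mat_commute
    by (auto simp: bar_def)
  then show ?thesis by blast
qed

end

theory Submission
  imports Defs
begin

text \<open>
  Let \<open>M = \<lambda>I - D\<close> and \<open>X = \<lambda>I - A\<close>. The first column of \<open>X\<close> vanishes, so only the first row
  \<open>(det M, u\<^sup>*)\<close> of \<open>adj X\<close> can be nonzero. As \<open>e\<^sub>1\<close> is an eigenvector of \<open>A\<close>, the first column of
  \<open>A\<^sup>*\<close> minus that of \<open>A\<close>-bar is \<open>(0, b)\<close>, so \<open>\<lambda>\<close> is a secondary value iff \<open>u\<^sup>* b = 0\<close>. The first
  row of \<open>adj X \<cdot> X = 0\<close> reads \<open>u\<^sup>* M = det M \<cdot> b\<^sup>*\<close>, hence \<open>u\<^sup>* M u\<close> vanishes when \<open>u\<^sup>* b\<close> does. If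
  \<open>\<lambda> \<notin> W(D)\<close>, this forces \<open>u = 0\<close>; since also \<open>det M \<noteq> 0\<close>, it follows that \<open>b = 0\<close>.
\<close>

lemma scaled_one_minus_mult_mat_vec:
  fixes D :: "'a :: comm_ring_1 mat"
  assumes D: "D \<in> carrier_mat m m" and u: "u \<in> carrier_vec m"
  shows "(x \<cdot>\<^sub>m 1\<^sub>m m - D) *\<^sub>v u = x \<cdot>\<^sub>v u - D *\<^sub>v u"
proof -
  have "(x \<cdot>\<^sub>m 1\<^sub>m m) *\<^sub>v u = x \<cdot>\<^sub>v u"
    using u by (intro eq_vecI) (auto simp: scalar_prod_def if_distrib if_distribR cong: if_cong)
  then show ?thesis
    using minus_mult_distrib_mat_vec[OF _ D u, of "x \<cdot>\<^sub>m 1\<^sub>m m"] by simp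
qed

text \<open>Expanding the quadratic form gives
  \<open>x * (u \<bullet>c u) = (D *\<^sub>v u) \<bullet>c u\<close>, and
  \<open>u \<bullet>c u\<close> may be divided out since \<open>u\<close> is nonzero.\<close>

lemma numerical_rangeI:
  assumes D: "D \<in> carrier_mat m m" and u: "u \<in> carrier_vec m" "u \<noteq> 0\<^sub>v m"
    and q: "((x \<cdot>\<^sub>m 1\<^sub>m m - D) *\<^sub>v u) \<bullet>c u = 0"
  shows "x \<in> numerical_range D"
proof -
  have Du: "D *\<^sub>v u \<in> carrier_vec m" using D u by auto
  have "x * (u \<bullet>c u) - (D *\<^sub>v u) \<bullet>c u = 0"
    using q u(1) Du
    by (simp add: scaled_one_minus_mult_mat_vec[OF D u(1)] minus_scalar_prod_distrib[of _ m])
  moreover have "u \<bullet>c u \<noteq> 0" using u by simp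
  ultimately have "x = ((D *\<^sub>v u) \<bullet>c u) / (u \<bullet>c u)" by (simp add: field_simps)
  then show ?thesis unfolding numerical_range_def using D u by auto
qed

text \<open>A nonzero kernel vector makes the quadratic form vanish: the numerical range contains
  the spectrum. In contrapositive form this supplies \<open>det M \<noteq> 0\<close>.\<close>

lemma det_zero_imp_in_numerical_range:
  assumes D: "D \<in> carrier_mat m m" and d: "det (x \<cdot>\<^sub>m 1\<^sub>m m - D) = 0"
  shows "x \<in> numerical_range D"
proof -
  have "x \<cdot>\<^sub>m 1\<^sub>m m - D \<in> carrier_mat m m" using D by auto
  from det_0_iff_vec_prod_zero[OF this] d obtain u
    where u: "u \<in> carrier_vec m" "u \<noteq> 0\<^sub>v m" "(x \<cdot>\<^sub>m 1\<^sub>m m - D) *\<^sub>v u = 0\<^sub>v m" by auto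
  show ?thesis by (rule numerical_rangeI[OF D u(1,2)]) (use u in simp)
qed

lemma mat_adjoint_carrier:
  "A \<in> carrier_mat n m \<Longrightarrow> mat_adjoint A \<in> carrier_mat m n"
  by (auto simp: mat_adjoint_def)

lemma mat_adjoint_index:
  "A \<in> carrier_mat n m \<Longrightarrow> i < m \<Longrightarrow> j < n \<Longrightarrow> mat_adjoint A $$ (i, j) = conjugate (A $$ (j, i))"
  by (auto simp: mat_adjoint_def mat_of_rows_def)

lemma det_zero_col:
  fixes A :: "'a :: comm_ring_1 mat"
  assumes "A \<in> carrier_mat n n" "j < n" "\<And>i. i < n \<Longrightarrow> A $$ (i, j) = 0"
  shows "det A = 0"
  using laplace_expansion_column[OF assms(1,2)] assms(3) by simp

text \<open>Entry \<open>(i, k)\<close> of the adjugate is, up to sign, the minor without row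
  \<open>k\<close> and column \<open>i\<close>. For \<open>0 < i\<close> this minor still contains
  the zero column.\<close>

lemma adj_mat_zero_first_col:
  fixes X :: "'a :: comm_ring_1 mat"
  assumes X: "X \<in> carrier_mat (Suc m) (Suc m)" and z: "\<And>i. i < Suc m \<Longrightarrow> X $$ (i, 0) = 0"
    and i: "0 < i" "i < Suc m" and k: "k < Suc m"
  shows "adj_mat X $$ (i, k) = 0"
proof -
  have "det (mat_delete X k i) = 0"
    by (rule det_zero_col[of _ m 0]) (use X z i in \<open>auto simp: mat_delete_def\<close>)
  then show ?thesis using X i k by (simp add: adj_mat_def cofactor_def)
qed

text \<open>With only row 0 of the adjugate left, the trace sees only column 0 of
  \<open>mat_adjoint A - bar A\<close>, which is 0 followed by \<open>b\<close>.\<close>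

lemma mat_trace_adj_mat_adjoint_minus_bar:
  fixes b :: "complex mat"
  assumes bar: "conj_map (Suc m) bar"
    and b: "b \<in> carrier_mat m 1" and D: "D \<in> carrier_mat m m"
    and A: "A = four_block_mat (mat 1 1 (\<lambda>_. lam)) (mat_adjoint b) (0\<^sub>m m 1) D"
  shows "mat_trace (adj_mat (lam \<cdot>\<^sub>m 1\<^sub>m (dim_row A) - A) * (mat_adjoint A - bar A))
    = (\<Sum>k<m. adj_mat (lam \<cdot>\<^sub>m 1\<^sub>m (Suc m) - A) $$ (0, Suc k) * b $$ (k, 0))"
proof -
  define X where "X = lam \<cdot>\<^sub>m 1\<^sub>m (Suc m) - A"
  have Ac: "A \<in> carrier_mat (Suc m) (Suc m)"
    using four_block_carrier_mat[of "mat 1 1 (\<lambda>_. lam)" 1 1 D m m] D by (simp add: A)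
  have Xc: "X \<in> carrier_mat (Suc m) (Suc m)" using Ac by (simp add: X_def minus_carrier_mat)
  have Y: "adj_mat X \<in> carrier_mat (Suc m) (Suc m)" using adj_mat(1)[OF Xc] .
  have barA: "bar A \<in> carrier_mat (Suc m) (Suc m)" using bar Ac by (simp add: conj_map_def)
  have A0: "A $$ (i, 0) = (if i = 0 then lam else 0)" if "i < Suc m" for i
    using that D b by (auto simp: A)
  \<comment> \<open>Column 0 of \<open>A\<close> makes the first unit vector an eigenvector, so
    column 0 of \<open>bar A\<close> is the same for every admissible \<open>bar\<close>.\<close>
  have "A *\<^sub>v unit_vec (Suc m) 0 = lam \<cdot>\<^sub>v unit_vec (Suc m) 0"
    using Ac A0 by (intro eq_vecI) auto
  then have e: "bar A *\<^sub>v unit_vec (Suc m) 0 = cnj lam \<cdot>\<^sub>v unit_vec (Suc m) 0"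
    using bar Ac unfolding conj_map_def by (meson unit_vec_carrier)
  have bar0: "bar A $$ (i, 0) = (if i = 0 then cnj lam else 0)" if "i < Suc m" for i
    using arg_cong[OF e, of "\<lambda>v. v $ i"] barA that by auto
  define K where "K = mat_adjoint A - bar A"
  have K: "K \<in> carrier_mat (Suc m) (Suc m)" using barA by (simp add: K_def minus_carrier_mat)
  have adjA: "mat_adjoint A $$ (i, 0) = cnj (A $$ (0, i))" if "i < Suc m" for i
    using mat_adjoint_index[OF Ac that] by simp
  \<comment> \<open>Both corner entries are \<open>cnj lam\<close>, so the corner entry of the
    adjugate drops out of the trace.\<close>
  have K0: "K $$ (0, 0) = 0"
    using adjA[of 0] A0[of 0] bar0[of 0] barA by (simp add: K_def)
  have Kb: "K $$ (Suc k, 0) = b $$ (k, 0)" if "k < m" for k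
  proof -
    have "A $$ (0, Suc k) = cnj (b $$ (k, 0))"
      using that D b mat_adjoint_carrier[OF b] mat_adjoint_index[OF b, of 0 k] by (simp add: A)
    then show ?thesis
      using adjA[of "Suc k"] bar0[of "Suc k"] barA that by (simp add: K_def)
  qed
  have X0: "X $$ (i, 0) = 0" if "i < Suc m" for i
    using that A0[OF that] Ac by (simp add: X_def)
  have "mat_trace (adj_mat X * K) = (\<Sum>i<Suc m. \<Sum>k<Suc m. adj_mat X $$ (i, k) * K $$ (k, i))"
    using Y K by (simp add: mat_trace_def scalar_prod_def atLeast0LessThan del: sum.lessThan_Suc)
  also have "\<dots> = (\<Sum>k<Suc m. adj_mat X $$ (0, k) * K $$ (k, 0))"
    by (simp add: sum.lessThan_Suc_shift adj_mat_zero_first_col[OF Xc X0] del: sum.lessThan_Suc)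
  also have "\<dots> = (\<Sum>k<m. adj_mat X $$ (0, Suc k) * b $$ (k, 0))"
    by (simp add: sum.lessThan_Suc_shift K0 Kb del: sum.lessThan_Suc)
  finally show ?thesis using Ac by (simp add: X_def K_def)
qed

text \<open>This is entry \<open>(0, Suc j)\<close> of \<open>adj_mat X * X = 0\<close>, where
  \<open>X\<close> is singular. The term with index 0 moves to the right; its minus sign comes from
  \<open>X = lam I - A\<close>.\<close>

lemma adj_mat_first_row:
  fixes b :: "complex mat"
  assumes b: "b \<in> carrier_mat m 1" and D: "D \<in> carrier_mat m m"
    and A: "A = four_block_mat (mat 1 1 (\<lambda>_. lam)) (mat_adjoint b) (0\<^sub>m m 1) D"
    and j: "j < m"
  shows "(\<Sum>k<m. adj_mat (lam \<cdot>\<^sub>m 1\<^sub>m (Suc m) - A) $$ (0, Suc k) * (lam \<cdot>\<^sub>m 1\<^sub>m m - D) $$ (k, j))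
    = det (lam \<cdot>\<^sub>m 1\<^sub>m m - D) * cnj (b $$ (j, 0))"
proof -
  define X where "X = lam \<cdot>\<^sub>m 1\<^sub>m (Suc m) - A"
  define M where "M = lam \<cdot>\<^sub>m 1\<^sub>m m - D"
  have Ac: "A \<in> carrier_mat (Suc m) (Suc m)"
    using four_block_carrier_mat[of "mat 1 1 (\<lambda>_. lam)" 1 1 D m m] D by (simp add: A)
  have Xc: "X \<in> carrier_mat (Suc m) (Suc m)" using Ac by (simp add: X_def minus_carrier_mat)
  have Y: "adj_mat X \<in> carrier_mat (Suc m) (Suc m)" using adj_mat(1)[OF Xc] .
  have "det X = 0"
    by (rule det_zero_col[OF Xc, of 0]) (use D b in \<open>auto simp: X_def A\<close>)
  then have "(adj_mat X * X) $$ (0, Suc j) = 0"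
    unfolding adj_mat(3)[OF Xc] using j by simp
  then have "(\<Sum>k<Suc m. adj_mat X $$ (0, k) * X $$ (k, Suc j)) = 0"
    using Y Xc j by (simp add: scalar_prod_def atLeast0LessThan del: sum.lessThan_Suc)
  moreover have "X $$ (0, Suc j) = - cnj (b $$ (j, 0))"
    using j D mat_adjoint_carrier[OF b] mat_adjoint_index[OF b, of 0 j] by (simp add: X_def A)
  moreover have XM: "X $$ (Suc k, Suc l) = M $$ (k, l)" if "k < m" "l < m" for k l
    using that b D by (simp add: X_def M_def A)
  \<comment> \<open>Removing row and column 0 from \<open>X\<close> leaves exactly \<open>M\<close>,
    and the cofactor sign is positive.\<close>
  moreover have "adj_mat X $$ (0, 0) = det M"
  proof -
    have "mat_delete X 0 0 = M"
      using XM D Xc by (intro eq_matI) (auto simp: mat_delete_def M_def)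
    then show ?thesis using Xc by (simp add: adj_mat_def cofactor_def)
  qed
  ultimately show ?thesis using j
    by (simp add: sum.lessThan_Suc_shift X_def[symmetric] M_def[symmetric] del: sum.lessThan_Suc)
qed

theorem theorem69:
  fixes n :: nat and bar :: "complex mat \<Rightarrow> complex mat"
    and lam :: complex and A b D :: "complex mat"
  assumes "n \<ge> 3"
    and "conj_map n bar"
    and "b \<in> carrier_mat (n - 1) 1"
    and "D \<in> carrier_mat (n - 1) (n - 1)"
    and "A = four_block_mat (mat 1 1 (\<lambda>_. lam)) (mat_adjoint b) (0\<^sub>m (n - 1) 1) D"
  shows "(b = 0\<^sub>m (n - 1) 1 \<longrightarrow> secondary_value bar A lam) \<and>
         (lam \<notin> numerical_range D \<and> secondary_value bar A lam \<longrightarrow> b = 0\<^sub>m (n - 1) 1)"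
proof -
  define m where "m = n - 1"
  have n: "n = Suc m" using assms(1) by (simp add: m_def)
  have bar: "conj_map (Suc m) bar" and b: "b \<in> carrier_mat m 1" and D: "D \<in> carrier_mat m m"
    and A: "A = four_block_mat (mat 1 1 (\<lambda>_. lam)) (mat_adjoint b) (0\<^sub>m m 1) D"
    using assms(2) assms(3-5)[folded m_def] unfolding n by simp_all
  define c where "c k = adj_mat (lam \<cdot>\<^sub>m 1\<^sub>m (Suc m) - A) $$ (0, Suc k)" for k
  define M where "M = lam \<cdot>\<^sub>m 1\<^sub>m m - D"
  have M: "M \<in> carrier_mat m m" using D by (simp add: M_def minus_carrier_mat)
  have sv: "secondary_value bar A lam \<longleftrightarrow> (\<Sum>k<m. c k * b $$ (k, 0)) = 0"
    unfolding secondary_value_def mat_trace_adj_mat_adjoint_minus_bar[OF bar b D A] c_def ..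
  have row: "(\<Sum>k<m. c k * M $$ (k, j)) = det M * cnj (b $$ (j, 0))" if "j < m" for j
    using adj_mat_first_row[OF b D A that] by (simp add: c_def M_def)
  have "b = 0\<^sub>m m 1" if W: "lam \<notin> numerical_range D" and s: "secondary_value bar A lam"
  proof -
    \<comment> \<open>Conjugated so that the row \<open>c\<close> is \<open>u\<^sup>*\<close>: the
      conjugation in \<open>\<bullet>c\<close> then restores \<open>c\<close>.\<close>
    define u where "u = vec m (\<lambda>k. cnj (c k))"
    have u: "u \<in> carrier_vec m" by (simp add: u_def)
    have "(M *\<^sub>v u) \<bullet>c u = (\<Sum>k<m. (\<Sum>j<m. M $$ (k, j) * cnj (c j)) * c k)"
      using M by (simp add: scalar_prod_def u_def atLeast0LessThan)
    \<comment> \<open>Summing over rows first exposes the entries of \<open>u\<^sup>* M\<close>, to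
      which \<open>row\<close> applies.\<close>
    also have "\<dots> = (\<Sum>j<m. (\<Sum>k<m. c k * M $$ (k, j)) * cnj (c j))"
      unfolding sum_distrib_right by (subst sum.swap) (simp add: mult_ac)
    \<comment> \<open>The conjugated sum is the one that \<open>sv\<close> equates to zero.\<close>
    also have "\<dots> = det M * cnj (\<Sum>j<m. c j * b $$ (j, 0))"
      by (simp add: row sum_distrib_left mult_ac)
    also have "\<dots> = 0" using s sv by simp
    finally have u0: "u = 0\<^sub>v m"
      using W numerical_rangeI[OF D u] by (auto simp: M_def)
    have "c k = 0" if "k < m" for k
    proof -
      have "u $ k = 0" using u0 that by simp
      then show ?thesis using that by (simp add: u_def)
    qed
    \<comment> \<open>With \<open>c\<close> zero, the left side of \<open>row\<close>
      vanishes.\<close>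
    then have "det M * cnj (b $$ (j, 0)) = 0" if "j < m" for j
      using row[OF that] by simp
    moreover have "det M \<noteq> 0"
      using W det_zero_imp_in_numerical_range[OF D] by (auto simp: M_def)
    ultimately show ?thesis using b by (intro eq_matI) auto
  qed
  moreover have "secondary_value bar A lam" if "b = 0\<^sub>m m 1"
    using that by (simp add: sv)
  ultimately show ?thesis by (auto simp: m_def)
qed

end
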